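(* Let $X=\begin{pmatrix}A&B\\C&D\end{pmatrix}\in su(p,q)$ (blocks of sizes $p\times p$, $p\times q$, $q\times p$, $q\times q$). Then, for each $z=(z_1,z_2)\in\mathbb{C}^p\times\mathbb{C}^q$, $$W(d\sigma(X))(z)=-\tfrac{\lambda}{2}\left((\overline C\bar z_1)\bar z_2+(\overline Dz_2)\bar z_2+(Az_1)\bar z_1-z_1(\overline Bz_2)\right).$$
   Context: Let $p,q$ be positive integers, $n=p+q$, and fix $\lambda>0$. For $u,v\in\mathbb{C}^m$ write $uv=\sum_j u_jv_j$ (no conjugation) and $|u|^2=u\bar u$; matrices act on vectors in the usual way. $\overline N$ is the entrywise conjugate and $N^\star$ the conjugate transpose of a matrix $N$. $SU(p,q)$ is the group of $k\in SL(n,\mathbb{C})$ with $kJ_0k^\star=J_0$, $J_0=\begin{pmatrix}I_p&0\\0&-I_q\end{pmatrix}$, and $su(p,q)$ is its Lie algebra. Fock space: $\mathcal{F}$ is the Hilbert space of holomorphic functions $f$ on $\mathbb{C}^n$ with $\|f\|^2=\left(\tfrac{\lambda}{2\pi}\right)^n\int_{\mathbb{C}^n}|f(z)|^2e^{-\lambda|z|^2/2}\,dm(z)<\infty$, $dm$ being Lebesgue measure. Put $dm_\lambda=\left(\tfrac{\lambda}{2\pi}\right)^n dm$ and $e_z(w)=\exp(\lambda\bar zw/2)$, so that $f(z)=\langle f,e_z\rangle$. The kernel of an operator $T$ on $\mathcal{F}$ (possibly an unbounded differential operator with polynomial coefficients) is $k_T(z,w)=\langle Te_w,e_z\rangle=(Te_w)(z)$.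 Complex Weyl symbol: $W(T)$ is the function on $\mathbb{C}^n$ defined by $$W(T)(z)=2^n\int_{\mathbb{C}^n}k_T(z+w,z-w)\exp\left(\tfrac{\lambda}{2}(-z\bar z-w\bar w+z\bar w-\bar zw)\right)dm_\lambda(w).$$ Harmonic representation: $\sigma$ is the unitary representation of $SU(p,q)$ on $\mathcal{F}$ such that for $k=\begin{pmatrix}A&B\\C&D\end{pmatrix}$ the operator $\sigma(k)$ has kernel $$b_k(z,w)=(\det A)^{-1}\exp\tfrac{\lambda}{2}\left(-(\overline D^{-1}\overline C\bar w_1)\bar w_2+(\overline D^{-1}z_2)\bar w_2+(A^{-1}z_1)\bar w_1+z_1(\overline B\,\overline D^{-1}z_2)\right),$$ where $z=(z_1,z_2)$, $w=(w_1,w_2)$, $z_1,w_1\in\mathbb{C}^p$, $z_2,w_2\in\mathbb{C}^q$. Its differential is $d\sigma(X)=\frac{d}{dt}\big|_{t=0}\sigma(\exp(tX))$ for $X\in su(p,q)$ (a differential operator with polynomial coefficients), so that the kernel of $d\sigma(X)$ is $\frac{d}{dt}\big|_{t=0}b_{\exp(tX)}(z,w)$. *)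

theory Defs
  imports "HOL-Analysis.Analysis"
begin

section \<open>Vectors and matrices\<close>

definition conj_vec :: "complex^'n \<Rightarrow> complex^'n" where
  "conj_vec u = (\<chi> i. cnj (u $ i))"

definition conj_transpose :: "complex^'n^'m \<Rightarrow> complex^'m^'n" where
  "conj_transpose N = transpose (map_matrix cnj N)"

text \<open>The space of column vectors of size \<open>p + q\<close> is \<open>complex^('p + 'q)\<close> with
  \<open>p = CARD('p)\<close> and \<open>q = CARD('q)\<close>; indices of the form \<^term>\<open>Inl i\<close> belong to the first block.\<close>

definition join_vec :: "'a^'p \<Rightarrow> 'a^'q \<Rightarrow> 'a^('p::finite + 'q::finite)" where
  "join_vec u v = (\<chi> i. case i of Inl a \<Rightarrow> u $ a | Inr b \<Rightarrow> v $ b)"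

definition vec1 :: "'a^('p::finite + 'q::finite) \<Rightarrow> 'a^'p" where
  "vec1 z = (\<chi> a. z $ Inl a)"

definition vec2 :: "'a^('p::finite + 'q::finite) \<Rightarrow> 'a^'q" where
  "vec2 z = (\<chi> b. z $ Inr b)"

definition block_matrix ::
  "'a^'p^'p \<Rightarrow> 'a^'q^'p \<Rightarrow> 'a^'p^'q \<Rightarrow> 'a^'q^'q \<Rightarrow> 'a^('p::finite + 'q::finite)^('p::finite + 'q::finite)" where
  "block_matrix A B C D = (\<chi> i j.
     case i of
       Inl a \<Rightarrow> (case j of Inl a' \<Rightarrow> A $ a $ a' | Inr b' \<Rightarrow> B $ a $ b')
     | Inr b \<Rightarrow> (case j of Inl a' \<Rightarrow> C $ b $ a' | Inr b' \<Rightarrow> D $ b $ b'))"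

definition block_A :: "'a^('p::finite + 'q::finite)^('p::finite + 'q::finite) \<Rightarrow> 'a^'p^'p" where
  "block_A k = (\<chi> a a'. k $ Inl a $ Inl a')"

definition block_B :: "'a^('p::finite + 'q::finite)^('p::finite + 'q::finite) \<Rightarrow> 'a^'q^'p" where
  "block_B k = (\<chi> a b'. k $ Inl a $ Inr b')"

definition block_C :: "'a^('p::finite + 'q::finite)^('p::finite + 'q::finite) \<Rightarrow> 'a^'p^'q" where
  "block_C k = (\<chi> b a'. k $ Inr b $ Inl a')"

definition block_D :: "'a^('p::finite + 'q::finite)^('p::finite + 'q::finite) \<Rightarrow> 'a^'q^'q" where
  "block_D k = (\<chi> b b'. k $ Inr b $ Inr b')"

lemma vec_join_vec [simp]: "vec1 (join_vec u v) = u" "vec2 (join_vec u v) = v"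
  by (simp_all add: vec1_def vec2_def join_vec_def)

lemma block_block_matrix [simp]:
  "block_A (block_matrix A B C D) = A" "block_B (block_matrix A B C D) = B"
  "block_C (block_matrix A B C D) = C" "block_D (block_matrix A B C D) = D"
  by (simp_all add: block_A_def block_B_def block_C_def block_D_def block_matrix_def)

text \<open>The library operation \<open>*\<close> on vectors, hence on matrices, is componentwise; powers and the
  exponential series are therefore built from \<^const>\<open>matrix_matrix_mult\<close>.\<close>

primrec matrix_pow :: "complex^'n^'n \<Rightarrow> nat \<Rightarrow> complex^'n^'n" where
  "matrix_pow X 0 = mat 1"
| "matrix_pow X (Suc m) = X ** matrix_pow X m"

definition matrix_exp :: "complex^'n^'n \<Rightarrow> complex^'n^'n" where
  "matrix_exp X = (\<Sum>m. (1 / fact m) *\<^sub>R matrix_pow X m)"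

section \<open>The group $SU(p,q)$ and its Lie algebra\<close>

definition J0 :: "complex^('p::finite + 'q::finite)^('p::finite + 'q::finite)" where
  "J0 = block_matrix (mat 1) 0 0 (- mat 1)"

definition SU_pq :: "(complex^('p::finite + 'q::finite)^('p::finite + 'q::finite)) set" where
  "SU_pq = {k. det k = 1 \<and> k ** J0 ** conj_transpose k = J0}"

text \<open>The Lie algebra of a closed matrix group.\<close>

definition lie_algebra :: "(complex^'n^'n) set \<Rightarrow> (complex^'n^'n) set" where
  "lie_algebra G = {X. \<forall>t::real. matrix_exp (t *\<^sub>R X) \<in> G}"

definition su_pq :: "(complex^('p::finite + 'q::finite)^('p::finite + 'q::finite)) set" where
  "su_pq = lie_algebra SU_pq"

section \<open>The Fock space\<close>

definition holomorphic_Cn :: "(complex^'n \<Rightarrow> complex) \<Rightarrow> bool" where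
  "holomorphic_Cn f \<longleftrightarrow>
     (\<forall>z. \<exists>f'. (f has_derivative f') (at z) \<and> (\<forall>c v. f' (c *s v) = c * f' v))"

definition dm_lambda :: "real \<Rightarrow> (complex^'n) measure" where
  "dm_lambda lam = density lborel (\<lambda>_. ennreal ((lam / (2 * pi)) ^ CARD('n)))"

definition fock_space :: "real \<Rightarrow> (complex^'n \<Rightarrow> complex) set" where
  "fock_space lam = {f. holomorphic_Cn f \<and>
     integrable (dm_lambda lam) (\<lambda>z. (cmod (f z))\<^sup>2 * exp (- lam * (norm z)\<^sup>2 / 2))}"

definition fock_inner :: "real \<Rightarrow> (complex^'n \<Rightarrow> complex) \<Rightarrow> (complex^'n \<Rightarrow> complex) \<Rightarrow> complex" where
  "fock_inner lam f g =
     (LINT z|dm_lambda lam. f z * cnj (g z) * of_real (exp (- lam * (norm z)\<^sup>2 / 2)))"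

definition fock_norm :: "real \<Rightarrow> (complex^'n \<Rightarrow> complex) \<Rightarrow> real" where
  "fock_norm lam f = sqrt (LINT z|dm_lambda lam. (cmod (f z))\<^sup>2 * exp (- lam * (norm z)\<^sup>2 / 2))"

definition coherent :: "real \<Rightarrow> complex^'n \<Rightarrow> complex^'n \<Rightarrow> complex" where
  "coherent lam z w = exp (of_real lam * scalar_product (conj_vec z) w / 2)"

text \<open>An operator is a map on functions; only its values on its domain are relevant.\<close>

type_synonym 'n operator = "(complex^'n \<Rightarrow> complex) \<Rightarrow> (complex^'n \<Rightarrow> complex)"

definition op_kernel :: "real \<Rightarrow> 'n::finite operator \<Rightarrow> complex^'n \<Rightarrow> complex^'n \<Rightarrow> complex" where
  "op_kernel lam T z w = T (coherent lam w) z"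

definition weyl_symbol :: "real \<Rightarrow> 'n::finite operator \<Rightarrow> complex^'n \<Rightarrow> complex" where
  "weyl_symbol lam T z = 2 ^ CARD('n) *
     (LINT w|dm_lambda lam. op_kernel lam T (z + w) (z - w) *
        exp (of_real (lam / 2) *
          (- scalar_product z (conj_vec z) - scalar_product w (conj_vec w)
           + scalar_product z (conj_vec w) - scalar_product (conj_vec z) w)))"

section \<open>The harmonic representation\<close>

definition unitary_on_fock :: "real \<Rightarrow> 'n::finite operator \<Rightarrow> bool" where
  "unitary_on_fock lam U \<longleftrightarrow>
     bij_betw U (fock_space lam) (fock_space lam) \<and>
     (\<forall>f\<in>fock_space lam. \<forall>g\<in>fock_space lam. \<forall>a b.
        U (\<lambda>z. a * f z + b * g z) = (\<lambda>z. a * U f z + b * U g z)) \<and>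
     (\<forall>f\<in>fock_space lam. \<forall>g\<in>fock_space lam. fock_inner lam (U f) (U g) = fock_inner lam f g)"

definition unitary_rep_on_fock ::
  "real \<Rightarrow> (complex^'m^'m) set \<Rightarrow> (complex^'m^'m \<Rightarrow> 'n::finite operator) \<Rightarrow> bool" where
  "unitary_rep_on_fock lam G \<sigma> \<longleftrightarrow>
     (\<forall>k\<in>G. unitary_on_fock lam (\<sigma> k)) \<and>
     (\<forall>k\<in>G. \<forall>l\<in>G. \<forall>f\<in>fock_space lam. \<sigma> (k ** l) f = \<sigma> k (\<sigma> l f)) \<and>
     (\<forall>f\<in>fock_space lam. \<forall>k\<in>G.
        ((\<lambda>l. fock_norm lam (\<lambda>z. \<sigma> l f z - \<sigma> k f z)) \<longlongrightarrow> 0) (at k within G))"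

definition harmonic_kernel ::
  "real \<Rightarrow> complex^('p::finite + 'q::finite)^('p::finite + 'q::finite) \<Rightarrow> complex^('p::finite + 'q::finite) \<Rightarrow> complex^('p::finite + 'q::finite) \<Rightarrow> complex" where
  "harmonic_kernel lam k z w =
    (let A = block_A k; B = block_B k; C = block_C k; D = block_D k;
         Dci = matrix_inv (map_matrix cnj D);
         z1 = vec1 z; z2 = vec2 z; w1c = conj_vec (vec1 w); w2c = conj_vec (vec2 w)
     in inverse (det A) * exp (of_real (lam / 2) *
          (- scalar_product (Dci *v (map_matrix cnj C *v w1c)) w2c
           + scalar_product (Dci *v z2) w2c
           + scalar_product (matrix_inv A *v z1) w1c
           + scalar_product z1 (map_matrix cnj B *v (Dci *v z2)))))"

text \<open>These conditions determine the operators on the Fock space, as a bounded operator there is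
  determined by its kernel.\<close>

definition is_harmonic_rep ::
  "real \<Rightarrow> (complex^('p::finite + 'q::finite)^('p::finite + 'q::finite) \<Rightarrow> ('p::finite + 'q::finite) operator) \<Rightarrow> bool" where
  "is_harmonic_rep lam \<sigma> \<longleftrightarrow>
     unitary_rep_on_fock lam SU_pq \<sigma> \<and>
     (\<forall>k\<in>SU_pq. \<forall>z w. op_kernel lam (\<sigma> k) z w = harmonic_kernel lam k z w)"

text \<open>The derivative along the one-parameter group is taken pointwise on the underlying space; where
  the derivative in the norm of the Fock space exists, it is the same, as evaluations are
  continuous.\<close>

definition rep_differential ::
  "(complex^'m^'m \<Rightarrow> 'n::finite operator) \<Rightarrow> complex^'m^'m \<Rightarrow> 'n operator" where
  "rep_differential \<sigma> X f z = vector_derivative (\<lambda>t. \<sigma> (matrix_exp (t *\<^sub>R X)) f z) (at 0)"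

end

theory Submission
  imports Defs "HOL-Probability.Distributions"
begin

text \<open>Since \<open>SU(p,q)\<close> contains \<open>exp (tX)\<close>, the kernel of \<open>d\<sigma>(X)\<close> is the derivative at \<open>t = 0\<close> of
  the explicit kernel of \<open>\<sigma>(exp (tX))\<close>; as \<open>exp (0X) = 1\<close>, the determinant contributes \<open>- tr A\<close>, each
  inverse block contributes minus its derivative, and the result is a quadratic polynomial times
  the reproducing kernel. In the Weyl integral all exponentials combine to \<open>exp (-\<lambda>|w|\<^sup>2)\<close>, so the
  integral is the value of the polynomial at \<open>w = 0\<close> plus \<open>1/(2\<lambda>)\<close> times the trace of its quadratic
  part over a real orthonormal basis, which gives \<open>(tr A + tr (cnj D)) / 2\<close>. Differentiating the equations of the
  group yields \<open>tr X = 0\<close> and \<open>D\<^sup>\<star> = - D\<close>, hence \<open>tr (cnj D) = tr A\<close>, and the traces cancel.\<close>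

section \<open>Gaussian integrals\<close>

text \<open>The integrand is \<open>sqrt (pi / c)\<close> times the centred normal density of
  variance \<open>1 / (2 * c)\<close>, so the three values are its moments of order 0, 1 and 2,
  rescaled.\<close>

lemma has_bochner_integral_gaussian_real:
  fixes c :: real
  assumes "c > 0"
  shows "has_bochner_integral lborel (\<lambda>x. exp (- c * x\<^sup>2)) (sqrt (pi / c))"
    and "has_bochner_integral lborel (\<lambda>x. exp (- c * x\<^sup>2) * x) 0"
    and "has_bochner_integral lborel (\<lambda>x. exp (- c * x\<^sup>2) * x\<^sup>2) (sqrt (pi / c) / (2 * c))"
proof -
  define s where "s = 1 / sqrt (2 * c)"
  have s: "s > 0" "s\<^sup>2 = 1 / (2 * c)"
    using assms by (simp_all add: s_def power_divide)
  have eq: "sqrt (pi / c) * normal_density 0 s x = exp (- c * x\<^sup>2)" for x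
    using assms by (simp add: normal_density_def s(2) real_sqrt_divide)
  show "has_bochner_integral lborel (\<lambda>x. exp (- c * x\<^sup>2)) (sqrt (pi / c))"
  proof -
    have "has_bochner_integral lborel (normal_density 0 s) 1"
      using normal_moment_even[OF s(1), of 0 0] by simp
    from has_bochner_integral_mult_right[OF this, of "sqrt (pi / c)"] show ?thesis
      unfolding eq by simp
  qed
  show "has_bochner_integral lborel (\<lambda>x. exp (- c * x\<^sup>2) * x) 0"
  proof -
    have "has_bochner_integral lborel (\<lambda>x. normal_density 0 s x * x) 0"
      using normal_moment_odd[OF s(1), of 0 0] by simp
    from has_bochner_integral_mult_right[OF this, of "sqrt (pi / c)"] show ?thesis
      unfolding mult.assoc[symmetric] eq by simp
  qed
  show "has_bochner_integral lborel (\<lambda>x. exp (- c * x\<^sup>2) * x\<^sup>2) (sqrt (pi / c) / (2 * c))"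
  proof -
    have "has_bochner_integral lborel (\<lambda>x. normal_density 0 s x * x\<^sup>2) (s\<^sup>2)"
      using normal_moment_even[OF s(1), of 0 1] by simp
    from has_bochner_integral_mult_right[OF this, of "sqrt (pi / c)"] show ?thesis
      unfolding mult.assoc[symmetric] eq s(2) by simp
  qed
qed

text \<open>Fubini for separated variables: Lebesgue measure on a Euclidean space is the image of
  the product of one-dimensional Lebesgue measures under the map that assembles a vector from its
  coordinates.\<close>

lemma has_bochner_integral_prod_Basis:
  fixes f :: "'a::euclidean_space \<Rightarrow> real \<Rightarrow> 'b::{real_normed_field,banach,second_countable_topology}"
  assumes "\<And>b. b \<in> Basis \<Longrightarrow> has_bochner_integral lborel (f b) (v b)"
  shows "has_bochner_integral lborel (\<lambda>x::'a. \<Prod>b\<in>Basis. f b (x \<bullet> b)) (\<Prod>b\<in>Basis. v b)"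
proof -
  interpret product_sigma_finite "\<lambda>_::'a. lborel :: real measure" ..
  have int: "integrable lborel (f b)" "integral\<^sup>L lborel (f b) = v b" if "b \<in> Basis" for b
    using assms[OF that] by (auto simp: has_bochner_integral_iff)
  have "has_bochner_integral (Pi\<^sub>M Basis (\<lambda>_::'a. lborel :: real measure)) (\<lambda>x. \<Prod>b\<in>Basis. f b (x b)) (\<Prod>b\<in>Basis. v b)"
    using product_integrable_prod[of Basis f] product_integral_prod[of Basis f] int
    by (auto simp: has_bochner_integral_iff)
  moreover have "(\<Prod>b\<in>Basis. f b ((\<Sum>a\<in>Basis. x a *\<^sub>R a) \<bullet> b)) = (\<Prod>b\<in>Basis. f b (x b))" for x :: "'a \<Rightarrow> real"
    by (intro prod.cong refl) simp
  moreover have "(\<lambda>x::'a. f b (x \<bullet> b)) \<in> borel_measurable borel" if "b \<in> Basis" for b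
    using measurable_compose[of "\<lambda>x::'a. x \<bullet> b" borel borel "f b" borel]
      borel_measurable_has_bochner_integral[OF assms[OF that]] by simp
  then have "(\<lambda>x::'a. \<Prod>b\<in>Basis. f b (x \<bullet> b)) \<in> borel_measurable borel"
    by (intro borel_measurable_prod)
  ultimately show ?thesis
    unfolding lborel_eq[where 'a='a]
    by (intro has_bochner_integral_distr) auto
qed

lemma exp_norm_square_eq_prod_Basis:
  fixes x :: "'a::euclidean_space"
  shows "exp (- c * (norm x)\<^sup>2) = (\<Prod>b\<in>Basis. exp (- c * (x \<bullet> b)\<^sup>2))"
proof -
  have "- c * (norm x)\<^sup>2 = (\<Sum>b\<in>Basis. - c * (x \<bullet> b)\<^sup>2)"
    unfolding power2_norm_eq_inner euclidean_inner[of x x] by (simp add: sum_distrib_left power2_eq_square)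
  then show ?thesis by (simp only: exp_sum[OF finite_Basis])
qed

text \<open>Each monomial of degree at most 2 is a product over all coordinates of one-variable
  functions, with the constant 1 where a coordinate does not occur. The integral then factors into
  one-dimensional moments.\<close>

lemma has_bochner_integral_gaussian_moments:
  fixes c :: real and a b :: "'a::euclidean_space"
  defines "Z \<equiv> sqrt (pi / c) ^ DIM('a)"
  assumes c: "c > 0" and ab: "a \<in> Basis" "b \<in> Basis"
  shows "has_bochner_integral lborel (\<lambda>x::'a. exp (- c * (norm x)\<^sup>2)) Z"
    and "has_bochner_integral lborel (\<lambda>x. exp (- c * (norm x)\<^sup>2) * (x \<bullet> a)) 0"
    and "has_bochner_integral lborel (\<lambda>x. exp (- c * (norm x)\<^sup>2) * ((x \<bullet> a) * (x \<bullet> b)))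
           (if a = b then Z / (2 * c) else 0)"
proof -
  have prod: "has_bochner_integral lborel (\<lambda>x::'a. exp (- c * (norm x)\<^sup>2) * (\<Prod>e\<in>Basis. g e (x \<bullet> e))) (\<Prod>e\<in>Basis. v e)"
    if "\<And>e. e \<in> Basis \<Longrightarrow> has_bochner_integral lborel (\<lambda>t. exp (- c * t\<^sup>2) * g e t) (v e)"
    for g :: "'a \<Rightarrow> real \<Rightarrow> real" and v
    using has_bochner_integral_prod_Basis[of "\<lambda>e t. exp (- c * t\<^sup>2) * g e t" v, OF that]
    by (simp only: exp_norm_square_eq_prod_Basis prod.distrib)
  note moment = has_bochner_integral_gaussian_real[OF c]
  show "has_bochner_integral lborel (\<lambda>x::'a. exp (- c * (norm x)\<^sup>2)) Z"
    using prod[of "\<lambda>_ _. 1" "\<lambda>_. sqrt (pi / c)"] moment(1) by (simp add: Z_def)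
  \<comment> \<open>The factor at \<open>a\<close> is a vanishing first moment, which makes the
    whole product 0.\<close>
  have "has_bochner_integral lborel (\<lambda>x. exp (- c * (norm x)\<^sup>2) * (\<Prod>e\<in>Basis. if e = a then x \<bullet> e else 1))
      (\<Prod>e\<in>Basis. if e = a then 0 else sqrt (pi / c))"
    by (rule prod) (use moment in auto)
  then show "has_bochner_integral lborel (\<lambda>x. exp (- c * (norm x)\<^sup>2) * (x \<bullet> a)) 0"
    using ab by (simp add: prod_zero[of Basis] bexI[of _ a])
  show "has_bochner_integral lborel (\<lambda>x. exp (- c * (norm x)\<^sup>2) * ((x \<bullet> a) * (x \<bullet> b)))
      (if a = b then Z / (2 * c) else 0)"
  proof (cases "a = b")
    case True
    have "has_bochner_integral lborel (\<lambda>x. exp (- c * (norm x)\<^sup>2) * (\<Prod>e\<in>Basis. if e = a then (x \<bullet> e)\<^sup>2 else 1))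
        (\<Prod>e\<in>Basis. sqrt (pi / c) * (if e = a then 1 / (2 * c) else 1))"
      by (rule prod) (use moment in auto)
    then show ?thesis
      using ab True by (simp add: prod.distrib Z_def power2_eq_square)
  next
    case False
    \<comment> \<open>For distinct directions the two linear factors fall on different coordinates,
      and each of these contributes a vanishing first moment.\<close>
    have "has_bochner_integral lborel (\<lambda>x. exp (- c * (norm x)\<^sup>2) *
          (\<Prod>e\<in>Basis. (if e = a then x \<bullet> e else 1) * (if e = b then x \<bullet> e else 1)))
        (\<Prod>e\<in>Basis. if e = a \<or> e = b then 0 else sqrt (pi / c))"
      by (rule prod[where g = "\<lambda>e t. (if e = a then t else 1) * (if e = b then t else 1)"]) (use moment False in auto)
    then show ?thesis
      using ab False by (simp add: prod.distrib prod_zero[of Basis] bexI[of _ a])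
  qed
qed

text \<open>Expanding \<open>L\<close> and \<open>Q\<close> in coordinates reduces the integral to
  moments: the linear part and the off-diagonal part integrate to 0, and each diagonal term of
  \<open>Q\<close> picks up \<open>1 / (2 * c)\<close> times the total mass.\<close>

lemma has_bochner_integral_gaussian_quadratic:
  fixes c :: real and L :: "'a::euclidean_space \<Rightarrow> 'b::{banach,second_countable_topology}"
    and Q :: "'a \<Rightarrow> 'a \<Rightarrow> 'b"
  assumes c: "c > 0" and L: "bounded_linear L" and Q: "bounded_bilinear Q"
  shows "has_bochner_integral lborel (\<lambda>x. exp (- c * (norm x)\<^sup>2) *\<^sub>R (q + L x + Q x x))
    (sqrt (pi / c) ^ DIM('a) *\<^sub>R (q + (1 / (2 * c)) *\<^sub>R (\<Sum>b\<in>Basis. Q b b)))"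
proof -
  interpret L: bounded_linear L by fact
  interpret Q: bounded_bilinear Q by fact
  let ?G = "\<lambda>x::'a. exp (- c * (norm x)\<^sup>2)" and ?Z = "sqrt (pi / c) ^ DIM('a)"
  note moment = has_bochner_integral_gaussian_moments[OF c]
  have Lx: "L x = (\<Sum>a\<in>Basis. (x \<bullet> a) *\<^sub>R L a)" for x
    by (subst euclidean_representation[of x, symmetric]) (simp only: L.sum L.scaleR)
  have Qx: "Q x x = (\<Sum>a\<in>Basis. \<Sum>b\<in>Basis. ((x \<bullet> a) * (x \<bullet> b)) *\<^sub>R Q a b)" for x
  proof -
    have "Q x x = Q (\<Sum>a\<in>Basis. (x \<bullet> a) *\<^sub>R a) (\<Sum>b\<in>Basis. (x \<bullet> b) *\<^sub>R b)"
      by (simp only: euclidean_representation)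
    then show ?thesis
      by (simp only: Q.sum_left Q.scaleR_left)
         (simp only: Q.sum_right Q.scaleR_right scaleR_sum_right scaleR_scaleR)
  qed
  \<comment> \<open>The moments are stated for a pair of basis vectors; \<open>e\<close> fills the
    places that a moment of degree 0 or 1 leaves open.\<close>
  obtain e :: 'a where e: "e \<in> Basis" using nonempty_Basis by blast
  have "has_bochner_integral lborel
      (\<lambda>x. ?G x *\<^sub>R q + (\<Sum>a\<in>Basis. (?G x * (x \<bullet> a)) *\<^sub>R L a)
        + (\<Sum>a\<in>Basis. \<Sum>b\<in>Basis. (?G x * ((x \<bullet> a) * (x \<bullet> b))) *\<^sub>R Q a b))
      (?Z *\<^sub>R q + (\<Sum>a\<in>Basis. (0::real) *\<^sub>R L a)
        + (\<Sum>a\<in>Basis. \<Sum>b\<in>Basis. (if a = b then ?Z / (2 * c) else 0) *\<^sub>R Q a b))"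
    by (intro has_bochner_integral_add has_bochner_integral_sum has_bochner_integral_scaleR_left
        moment(1)[OF e e] moment(2)[OF _ e] moment(3))
  moreover have "(\<Sum>a\<in>Basis. \<Sum>b\<in>Basis. (if a = b then ?Z / (2 * c) else 0) *\<^sub>R Q a b)
      = (?Z / (2 * c)) *\<^sub>R (\<Sum>b\<in>Basis. Q b b)"
    by (simp add: if_distrib[of "\<lambda>r. r *\<^sub>R _"] scaleR_sum_right cong: if_cong)
  moreover have "?G x *\<^sub>R q + (\<Sum>a\<in>Basis. (?G x * (x \<bullet> a)) *\<^sub>R L a)
      + (\<Sum>a\<in>Basis. \<Sum>b\<in>Basis. (?G x * ((x \<bullet> a) * (x \<bullet> b))) *\<^sub>R Q a b)
      = ?G x *\<^sub>R (q + L x + Q x x)" for x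
    unfolding Lx[of x] Qx[of x] by (simp only: scaleR_add_right scaleR_sum_right scaleR_scaleR)
  ultimately show ?thesis
    by (simp only: scaleR_add_right scaleR_scaleR) (simp add: algebra_simps)
qed

text \<open>Turns a trace over the real basis into a sum over coordinates and, within each
  coordinate, over the real directions of the entry space, which are 1 and \<i> for complex
  entries.\<close>

lemma sum_Basis_vec:
  "(\<Sum>b\<in>Basis. f b) = (\<Sum>i\<in>UNIV. \<Sum>u\<in>Basis. f (axis i u :: 'a::euclidean_space^'n))"
proof -
  have eq: "(Basis :: ('a^'n) set) = (\<lambda>(i, u). axis i u) ` (UNIV \<times> Basis)"
    by (auto simp: Basis_vec_def)
  have inj: "inj_on (\<lambda>(i, u). axis i u :: 'a^'n) (UNIV \<times> Basis)"
    by (auto simp: inj_on_def axis_eq_axis)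
  show ?thesis
    unfolding eq sum.reindex[OF inj] by (simp add: sum.cartesian_product o_def case_prod_unfold)
qed

section \<open>Derivatives of matrix functions at the identity\<close>

text \<open>For the converse, a vector is the finite sum of its entries placed along the axes, and
  each placement is bounded linear.\<close>

lemma has_derivative_vec_iff:
  fixes f :: "'a::real_normed_vector \<Rightarrow> 'b::real_normed_vector^'n"
  shows "(f has_derivative f') F \<longleftrightarrow> (\<forall>i. ((\<lambda>x. f x $ i) has_derivative (\<lambda>h. f' h $ i)) F)"
proof
  assume "(f has_derivative f') F"
  then show "\<forall>i. ((\<lambda>x. f x $ i) has_derivative (\<lambda>h. f' h $ i)) F"
    by (blast intro: bounded_linear.has_derivative[OF bounded_linear_vec_nth])
next
  assume *: "\<forall>i. ((\<lambda>x. f x $ i) has_derivative (\<lambda>h. f' h $ i)) F"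
  have ax: "bounded_linear (axis i :: 'b \<Rightarrow> 'b^'n)" for i
    by (rule bounded_linear_intro[where K=1]) (auto simp: axis_def vec_eq_iff norm_vec_def L2_set_def if_distrib[of norm] if_distrib[of "\<lambda>x. x\<^sup>2"] cong: if_cong)
  have eq: "g = (\<lambda>x. \<Sum>i\<in>UNIV. axis i (g x $ i))" for g :: "'a \<Rightarrow> 'b^'n"
    by (auto simp: fun_eq_iff vec_eq_iff axis_def)
  show "(f has_derivative f') F"
    by (subst eq[of f], subst eq[of f']) (intro has_derivative_sum bounded_linear.has_derivative[OF ax] *[rule_format])
qed

text \<open>Jacobi's formula at the identity, from the Leibniz expansion: after the product rule
  every undifferentiated factor is an entry of \<open>mat 1\<close>, so only the identity
  permutation survives.\<close>

lemma has_derivative_det_mat1: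
  fixes M :: "'a::real_normed_vector \<Rightarrow> 'b::real_normed_field^'n^'n"
  assumes M: "(M has_derivative M') (at x within S)" and x: "M x = mat 1"
  shows "((\<lambda>t. det (M t)) has_derivative (\<lambda>h. trace (M' h))) (at x within S)"
proof -
  have entry: "((\<lambda>t. M t $ i $ j) has_derivative (\<lambda>h. M' h $ i $ j)) (at x within S)" for i j
    using M by (simp add: has_derivative_vec_iff)
  let ?P = "{p. p permutes (UNIV :: 'n set)}"
  \<comment> \<open>The derivative of the summand of \<open>p\<close>: in turn the factor with index
    \<open>i\<close> is differentiated and the others are evaluated at \<open>x\<close>.\<close>
  define d where "d p h = of_int (sign p) * (\<Sum>i\<in>UNIV. M' h $ i $ p i * (\<Prod>j\<in>UNIV - {i}. mat 1 $ j $ p j))" for p h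
  have d0: "d p h = (if p = id then trace (M' h) else 0)" if "p permutes UNIV" for p h
  proof (cases "p = id")
    case True
    then show ?thesis by (simp add: d_def trace_def mat_def)
  next
    case False
    \<comment> \<open>A nontrivial permutation moves at least two points, so one factor off the diagonal remains.\<close>
    then obtain a where a: "p a \<noteq> a" by (auto simp: fun_eq_iff)
    have "p (p a) \<noteq> p a"
      using a permutes_inj[OF that] by (auto dest: injD)
    have "(\<Prod>j\<in>UNIV - {i}. (mat 1 :: 'b^'n^'n) $ j $ p j) = 0" for i
    proof -
      have "\<exists>j\<in>UNIV - {i}. (mat 1 :: 'b^'n^'n) $ j $ p j = 0"
        using a \<open>p (p a) \<noteq> p a\<close> by (cases "i = a") (auto simp: mat_def intro: bexI[of _ a] bexI[of _ "p a"])
      then show ?thesis by (intro prod_zero) auto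
    qed
    then show ?thesis using False by (simp add: d_def del: prod_zero_iff)
  qed
  have "((\<lambda>t. det (M t)) has_derivative (\<lambda>h. \<Sum>p\<in>?P. d p h)) (at x within S)"
    unfolding det_def d_def x[symmetric]
    by (intro has_derivative_sum has_derivative_mult_right has_derivative_prod entry)
  moreover have "(\<Sum>p\<in>?P. d p h) = trace (M' h)" for h
  proof -
    have "(\<Sum>p\<in>?P. d p h) = (\<Sum>p\<in>?P. if p = id then trace (M' h) else 0)"
      by (intro sum.cong) (auto simp: d0)
    also have "\<dots> = trace (M' h)"
      by (subst sum.delta) (auto simp: finite_permutations)
    finally show ?thesis .
  qed
  ultimately show ?thesis by simp
qed

text \<open>The determinant is a polynomial in the entries. This form is for the numerators in
  Cramer's rule, whose matrices at the base point need not be the identity.\<close>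

lemma differentiable_det:
  fixes M :: "'a::real_normed_vector \<Rightarrow> 'b::real_normed_field^'n^'n"
  assumes "\<And>i j. (\<lambda>t. M t $ i $ j) differentiable (at x within S)"
  shows "(\<lambda>t. det (M t)) differentiable (at x within S)"
proof -
  have "(\<lambda>t. \<Prod>i\<in>UNIV. M t $ i $ p i) differentiable (at x within S)" for p
  proof -
    have "\<forall>i. \<exists>D. ((\<lambda>t. M t $ i $ p i) has_derivative D) (at x within S)"
      using assms by (auto simp: differentiable_def)
    then obtain D where "\<And>i. ((\<lambda>t. M t $ i $ p i) has_derivative D i) (at x within S)"
      by metis
    then show ?thesis
      unfolding differentiable_def
      using has_derivative_prod[of UNIV "\<lambda>i t. M t $ i $ p i" D x S] by blast
  qed
  then show ?thesis
    unfolding det_def by (intro differentiable_sum ballI differentiable_mult differentiable_const) (auto simp: finite_permutations)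
qed

section \<open>Real bilinear products of matrices and vectors\<close>

text \<open>In finite dimension bilinearity already implies boundedness, which makes the general
  product rule for derivatives available.\<close>

lemma bounded_bilinear_matrix_matrix_mult:
  "bounded_bilinear ((**) :: complex^'n^'m \<Rightarrow> complex^'k^'n \<Rightarrow> complex^'k^'m)"
  unfolding bilinear_conv_bounded_bilinear[symmetric]
  by (auto simp: bilinear_def matrix_matrix_mult_def vec_eq_iff distrib_left distrib_right sum.distrib scaleR_sum_right intro!: linearI)

lemma bounded_bilinear_matrix_vector_mult_complex:
  "bounded_bilinear ((*v) :: complex^'n^'m \<Rightarrow> complex^'n \<Rightarrow> complex^'m)"
  unfolding bilinear_conv_bounded_bilinear[symmetric]
  by (auto simp: bilinear_def matrix_vector_mult_def vec_eq_iff distrib_left distrib_right sum.distrib scaleR_sum_right intro!: linearI)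

lemma bounded_bilinear_scalar_product:
  "bounded_bilinear (scalar_product :: complex^'n \<Rightarrow> complex^'n \<Rightarrow> complex)"
  unfolding bilinear_conv_bounded_bilinear[symmetric]
  by (auto simp: bilinear_def scalar_product_def vec_eq_iff distrib_left distrib_right sum.distrib scaleR_sum_right intro!: linearI)

section \<open>Inverse matrices and their derivative at the identity\<close>

lemma matrix_inv_complex:
  fixes M :: "complex^'n^'n"
  assumes "det M \<noteq> 0"
  shows "M ** matrix_inv M = mat 1" "matrix_inv M ** M = mat 1"
  using assms someI_ex[of "\<lambda>A'. M ** A' = mat 1 \<and> A' ** M = mat 1"]
  unfolding invertible_det_nz[symmetric] matrix_inv_def invertible_def by auto

text \<open>Cramer's rule shows that the entries of the inverse are differentiable; the value of the
  derivative then follows from the product rule.\<close>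

lemma has_derivative_matrix_inv_mat1:
  fixes M :: "'a::real_normed_vector \<Rightarrow> complex^'n^'n"
  assumes M: "(M has_derivative M') (at x)" and x: "M x = mat 1"
  shows "((\<lambda>t. matrix_inv (M t)) has_derivative (\<lambda>h. - M' h)) (at x)"
proof -
  have entry: "(\<lambda>t. M t $ i $ j) differentiable (at x)" for i j
    using M by (auto simp: has_derivative_vec_iff differentiable_def)
  \<comment> \<open>Column \<open>l\<close> of the inverse solves the linear system whose right-hand
    side is column \<open>l\<close> of the identity; Cramer's rule gives its entry
    \<open>k\<close>.\<close>
  define N where "N t = (\<chi> k l. det (\<chi> i j. if j = k then mat 1 $ i $ l else M t $ i $ j) / det (M t))" for t
  have N: "N t = matrix_inv (M t)" if "det (M t) \<noteq> 0" for t
  proof -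
    have "M t *v (\<chi> k. N t $ k $ l) = (\<chi> i. mat 1 $ i $ l)" for l
      by (subst cramer[OF that]) (simp add: N_def cong: if_cong)
    then have "M t ** N t = mat 1"
      by (auto simp: vec_eq_iff matrix_matrix_mult_def matrix_vector_mult_def)
    then show ?thesis
      using matrix_inv_complex[OF that] by (metis matrix_mul_assoc matrix_mul_lid matrix_mul_rid)
  qed
  have "(\<lambda>t. det (M t)) differentiable (at x)"
    by (intro differentiable_det entry)
  then have "isCont (\<lambda>t. det (M t)) x"
    by (rule differentiable_imp_continuous_within)
  \<comment> \<open>Cramer's formula and the inverse thus agree on a whole neighbourhood of
    \<open>x\<close>, which is what allows derivatives to be transferred.\<close>
  then have ev: "\<forall>\<^sub>F t in nhds x. det (M t) \<noteq> 0"
    using x tendsto_imp_eventually_ne[of "\<lambda>t. det (M t)" 1 "at x" 0]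
    by (simp add: continuous_at eventually_nhds_conv_at)
  have "(\<lambda>t. N t $ k $ l) differentiable (at x)" for k l
  proof -
    have "(\<lambda>t. (\<chi> i j. if j = k then mat 1 $ i $ l else M t $ i $ j) $ i $ j) differentiable (at x)" for i j
      using entry by (cases "j = k") auto
    then show ?thesis
      using x by (auto simp: N_def intro!: differentiable_divide differentiable_det entry)
  qed
  then obtain N' where "\<And>k l. ((\<lambda>t. N t $ k $ l) has_derivative N' k l) (at x)"
    unfolding differentiable_def by metis
  then have N': "(N has_derivative (\<lambda>h. \<chi> k l. N' k l h)) (at x)"
    by (simp add: has_derivative_vec_iff)
  have Nx: "N x = mat 1"
    using N[of x] matrix_inv_complex[of "M x"] by (simp add: x)
  \<comment> \<open>The product is the identity near \<open>x\<close>, so this derivative is also 0;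
    with both factors equal to \<open>mat 1\<close> at \<open>x\<close>, the derivative of
    \<open>N\<close> is \<open>- M' h\<close>.\<close>
  have "((\<lambda>t. M t ** N t) has_derivative (\<lambda>h. M x ** (\<chi> k l. N' k l h) + M' h ** N x)) (at x)"
    by (rule bounded_bilinear.FDERIV[OF bounded_bilinear_matrix_matrix_mult M N'])
  moreover have "((\<lambda>t. M t ** N t) has_derivative (\<lambda>h. 0)) (at x)"
    by (rule has_derivative_transform_eventually[OF has_derivative_const[of "mat 1"]])
       (use ev x Nx in \<open>auto simp: eventually_at_filter N matrix_inv_complex elim!: eventually_mono\<close>)
  ultimately have "(\<lambda>h. M x ** (\<chi> k l. N' k l h) + M' h ** N x) = (\<lambda>h. 0)"
    by (rule has_derivative_unique)
  then have "(\<lambda>h. \<chi> k l. N' k l h) = (\<lambda>h. - M' h)"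
    by (simp add: x Nx fun_eq_iff eq_neg_iff_add_eq_0)
  with N' have "(N has_derivative (\<lambda>h. - M' h)) (at x)" by simp
  then show ?thesis
    by (rule has_derivative_transform_eventually)
       (use ev x N in \<open>auto simp: eventually_at_filter elim!: eventually_mono\<close>)
qed

section \<open>The exponential series of a matrix\<close>

text \<open>Bounded bilinearity makes the norm submultiplicative up to a constant, which is absorbed
  into the ratio of the geometric bound; the exponential series then dominates.\<close>

lemma norm_matrix_pow_le:
  fixes X :: "complex^'n^'n"
  obtains K where "\<And>m. norm (matrix_pow X m) \<le> norm (mat 1 :: complex^'n^'n) * K ^ m"
proof -
  obtain K where K: "K > 0" "\<And>(a :: complex^'n^'n) (b :: complex^'n^'n). norm (a ** b) \<le> norm a * norm b * K"
    using bounded_bilinear.pos_bounded[OF bounded_bilinear_matrix_matrix_mult] by blast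
  have "norm (matrix_pow X m) \<le> norm (mat 1 :: complex^'n^'n) * (norm X * K) ^ m" for m
  proof (induction m)
    case (Suc m)
    have "norm (matrix_pow X (Suc m)) \<le> norm X * norm (matrix_pow X m) * K"
      using K(2) by simp
    also have "\<dots> \<le> norm X * (norm (mat 1 :: complex^'n^'n) * (norm X * K) ^ m) * K"
      using Suc K(1) by (intro mult_right_mono mult_left_mono) auto
    finally show ?case by (simp add: mult_ac)
  qed simp
  then show ?thesis using that by blast
qed

lemma matrix_pow_scaleR: "matrix_pow (t *\<^sub>R X) m = t ^ m *\<^sub>R matrix_pow X m"
  by (induction m)
     (simp_all add: bounded_bilinear.scaleR_left[OF bounded_bilinear_matrix_matrix_mult]
       bounded_bilinear.scaleR_right[OF bounded_bilinear_matrix_matrix_mult])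

lemma summable_matrix_exp:
  fixes X :: "complex^'n^'n"
  shows "summable (\<lambda>m. (1 / fact m) *\<^sub>R matrix_pow X m)"
proof -
  obtain K where K: "\<And>m. norm (matrix_pow X m) \<le> norm (mat 1 :: complex^'n^'n) * K ^ m"
    using norm_matrix_pow_le by blast
  have "summable (\<lambda>m. norm (mat 1 :: complex^'n^'n) * (inverse (fact m) * K ^ m))"
    by (intro summable_mult summable_exp)
  then show ?thesis
    by (rule summable_comparison_test') (use K in \<open>auto simp: field_simps\<close>)
qed

lemma matrix_exp_0: "matrix_exp (0 :: complex^'n^'n) = mat 1"
proof -
  have "matrix_pow (0 :: complex^'n^'n) m = (if m = 0 then mat 1 else 0)" for m
    by (cases m) (auto simp: bounded_bilinear.zero_left[OF bounded_bilinear_matrix_matrix_mult])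
  then have "matrix_exp (0 :: complex^'n^'n) = (\<Sum>m. if m = 0 then mat 1 else 0)"
    unfolding matrix_exp_def by (intro suminf_cong) auto
  also have "\<dots> = mat 1"
    by (subst suminf_finite[of "{0}"]) auto
  finally show ?thesis .
qed

text \<open>Each entry is an everywhere convergent power series in \<open>t\<close>, so its
  derivative at 0 is the coefficient of degree 1, the entry of \<open>X\<close>.\<close>

lemma has_derivative_matrix_exp:
  fixes X :: "complex^'n^'n"
  shows "((\<lambda>t. matrix_exp (t *\<^sub>R X)) has_derivative (\<lambda>h. h *\<^sub>R X)) (at 0)"
  unfolding has_derivative_vec_iff
proof (intro allI)
  fix i j
  define c where "c m = matrix_pow X m $ i $ j / fact m" for m
  have bl: "bounded_linear (\<lambda>M :: complex^'n^'n. M $ i $ j)"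
    by (intro bounded_linear_compose[OF bounded_linear_vec_nth bounded_linear_vec_nth])
  have sm: "summable (\<lambda>m. c m * y ^ m)" for y
  proof -
    obtain K where K: "\<And>m. norm (matrix_pow X m) \<le> norm (mat 1 :: complex^'n^'n) * K ^ m"
      using norm_matrix_pow_le by blast
    have "summable (\<lambda>m. norm (mat 1 :: complex^'n^'n) * (inverse (fact m) * (K * norm y) ^ m))"
      by (intro summable_mult summable_exp)
    moreover have "norm (c m * y ^ m) \<le> norm (mat 1 :: complex^'n^'n) * (inverse (fact m) * (K * norm y) ^ m)" for m
    proof -
      have "norm (matrix_pow X m $ i $ j) \<le> norm (mat 1 :: complex^'n^'n) * K ^ m"
        using K[of m] Finite_Cartesian_Product.norm_nth_le order_trans by metis
      then have "norm (matrix_pow X m $ i $ j) * (norm y ^ m / fact m) \<le> norm (mat 1 :: complex^'n^'n) * K ^ m * (norm y ^ m / fact m)"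
        by (intro mult_right_mono) auto
      then show ?thesis
        by (simp add: c_def norm_mult norm_divide norm_power field_simps)
    qed
    ultimately show ?thesis by (rule summable_comparison_test')
  qed
  \<comment> \<open>The series is differentiated in a complex variable and then restricted to the
    real line.\<close>
  have "((\<lambda>y. \<Sum>m. c m * y ^ m) has_field_derivative c 1) (at 0)"
    using termdiffs_strong_converges_everywhere[of c 0, OF sm] by (simp add: diffs_def)
  then have "((\<lambda>t. \<Sum>m. c m * of_real t ^ m) has_vector_derivative c 1) (at (0::real))"
    using has_vector_derivative_real_field[of "\<lambda>y. \<Sum>m. c m * y ^ m" "c 1" 0] by simp
  moreover have "matrix_exp (t *\<^sub>R X) $ i $ j = (\<Sum>m. c m * of_real t ^ m)" for t
    unfolding matrix_exp_def
    by (subst bounded_linear.suminf[OF bl summable_matrix_exp])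
       (auto simp: c_def matrix_pow_scaleR scaleR_conv_of_real[where 'a=complex] intro!: suminf_cong)
  ultimately show "((\<lambda>t. matrix_exp (t *\<^sub>R X) $ i $ j) has_derivative (\<lambda>h. (h *\<^sub>R X) $ i $ j)) (at 0)"
    by (simp add: has_vector_derivative_def c_def)
qed

section \<open>The kernel and its Weyl symbol\<close>

lemma bounded_linear_blocks:
  "bounded_linear (block_A :: complex^('p::finite + 'q::finite)^('p + 'q) \<Rightarrow> _)"
  "bounded_linear (block_B :: complex^('p::finite + 'q::finite)^('p + 'q) \<Rightarrow> _)"
  "bounded_linear (block_C :: complex^('p::finite + 'q::finite)^('p + 'q) \<Rightarrow> _)"
  "bounded_linear (block_D :: complex^('p::finite + 'q::finite)^('p + 'q) \<Rightarrow> _)"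
  "bounded_linear (vec1 :: complex^('p + 'q) \<Rightarrow> _)"
  "bounded_linear (vec2 :: complex^('p + 'q) \<Rightarrow> _)"
  unfolding linear_conv_bounded_linear[symmetric]
  by (auto intro!: linearI simp: vec_eq_iff block_A_def block_B_def block_C_def block_D_def vec1_def vec2_def)

text \<open>Conjugation is linear over the reals only, which is the linearity that real derivatives
  and the sums over a real basis require.\<close>

lemma bounded_linear_conj:
  "bounded_linear (conj_vec :: complex^'n \<Rightarrow> _)"
  "bounded_linear (map_matrix cnj :: complex^'n^'m \<Rightarrow> _)"
  "bounded_linear (conj_transpose :: complex^'n^'m \<Rightarrow> _)"
  unfolding linear_conv_bounded_linear[symmetric]
  by (auto intro!: linearI simp: vec_eq_iff conj_vec_def conj_transpose_def map_matrix_def transpose_def)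

lemma block_mat1:
  "block_A (mat 1 :: complex^('p::finite + 'q::finite)^('p + 'q)) = mat 1"
  "block_B (mat 1 :: complex^('p::finite + 'q::finite)^('p + 'q)) = 0"
  "block_C (mat 1 :: complex^('p::finite + 'q::finite)^('p + 'q)) = 0"
  "block_D (mat 1 :: complex^('p::finite + 'q::finite)^('p + 'q)) = mat 1"
  by (simp_all add: vec_eq_iff mat_def block_A_def block_B_def block_C_def block_D_def)

lemma map_matrix_cnj_simps:
  "map_matrix cnj (mat 1 :: complex^'n^'n) = mat 1" "map_matrix cnj (0 :: complex^'n^'m) = 0"
  by (simp_all add: vec_eq_iff map_matrix_def mat_def)

lemma vec12_conj_vec: "vec1 (conj_vec w) = conj_vec (vec1 w)" "vec2 (conj_vec w) = conj_vec (vec2 w)"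
  by (simp_all add: vec_eq_iff vec1_def vec2_def conj_vec_def)

lemma sum_UNIV_Plus:
  "(\<Sum>i\<in>UNIV. f (i :: 'p::finite + 'q::finite)) = (\<Sum>a\<in>UNIV. f (Inl a)) + (\<Sum>b\<in>UNIV. f (Inr b))"
  by (simp add: UNIV_Plus_UNIV[symmetric] sum.Plus del: UNIV_Plus_UNIV)

lemma scalar_product_vec1_vec2:
  "scalar_product z w = scalar_product (vec1 z) (vec1 w) + scalar_product (vec2 z) (vec2 w)"
  by (simp add: scalar_product_def sum_UNIV_Plus vec1_def vec2_def)

lemma trace_block:
  "trace (X :: complex^('p::finite + 'q::finite)^('p + 'q)) = trace (block_A X) + trace (block_D X)"
  by (simp add: trace_def sum_UNIV_Plus block_A_def block_D_def)

lemma matrix_inv_mat1: "matrix_inv (mat 1 :: complex^'n^'n) = mat 1"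
  using matrix_inv_complex(1)[of "mat 1 :: complex^'n^'n"] by simp

text \<open>At the identity the blocks \<open>B\<close> and \<open>C\<close> vanish, so in the terms
  that contain them only their own derivatives survive, multiplied by identity matrices. The
  exponent itself reduces there to the pairing of \<open>z\<close> with
  \<open>conj_vec w\<close>.\<close>

lemma has_derivative_harmonic_kernel_mat1:
  fixes M :: "'a::real_normed_vector \<Rightarrow> complex^('p::finite + 'q::finite)^('p + 'q)"
  assumes M: "(M has_derivative M') (at x)" and x: "M x = mat 1"
  shows "((\<lambda>t. harmonic_kernel lam (M t) z w) has_derivative
    (\<lambda>h. exp (of_real (lam / 2) * scalar_product z (conj_vec w)) *
      (of_real (lam / 2) *
        (- scalar_product (map_matrix cnj (block_C (M' h)) *v vec1 (conj_vec w)) (vec2 (conj_vec w))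
         - scalar_product (map_matrix cnj (block_D (M' h)) *v vec2 z) (vec2 (conj_vec w))
         - scalar_product (block_A (M' h) *v vec1 z) (vec1 (conj_vec w))
         + scalar_product (vec1 z) (map_matrix cnj (block_B (M' h)) *v vec2 z))
       - trace (block_A (M' h))))) (at x)"
proof -
  note bl = bounded_linear.has_derivative[OF bounded_linear_blocks(1) M]
    bounded_linear.has_derivative[OF bounded_linear_conj(2) bounded_linear.has_derivative[OF bounded_linear_blocks(2) M]]
    bounded_linear.has_derivative[OF bounded_linear_conj(2) bounded_linear.has_derivative[OF bounded_linear_blocks(3) M]]
    bounded_linear.has_derivative[OF bounded_linear_conj(2) bounded_linear.has_derivative[OF bounded_linear_blocks(4) M]]
  note mv = bounded_bilinear.FDERIV[OF bounded_bilinear_matrix_vector_mult_complex]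
  note sp = bounded_bilinear.FDERIV[OF bounded_bilinear_scalar_product]
  note sp_simps = bounded_bilinear.zero_left[OF bounded_bilinear_scalar_product]
    bounded_bilinear.zero_right[OF bounded_bilinear_scalar_product]
    bounded_bilinear.minus_left[OF bounded_bilinear_scalar_product]
    bounded_bilinear.zero_left[OF bounded_bilinear_matrix_vector_mult_complex]
    bounded_bilinear.zero_right[OF bounded_bilinear_matrix_vector_mult_complex]
    bounded_bilinear.minus_left[OF bounded_bilinear_matrix_vector_mult_complex]
  note invA = has_derivative_matrix_inv_mat1[OF bl(1)]
  note invD = has_derivative_matrix_inv_mat1[OF bl(4)]
  have Ax: "block_A (M x) = mat 1" and Dx: "map_matrix cnj (block_D (M x)) = mat 1"
    by (simp_all add: x block_mat1 map_matrix_cnj_simps)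
  note exp = has_derivative_compose[OF _ DERIV_exp[unfolded has_field_derivative_def]]
  have nz: "det (block_A (M x)) \<noteq> 0" by (simp add: Ax)
  show ?thesis
    unfolding harmonic_kernel_def Let_def
    \<comment> \<open>The derivative is first assembled from the product and chain rules with all
      inverses still in it, and only then evaluated at the identity.\<close>
    by (rule has_derivative_eq_rhs,
        (rule has_derivative_mult Deriv.has_derivative_inverse has_derivative_det_mat1 exp
          has_derivative_add has_derivative_minus sp mv bl invA invD has_derivative_const Ax Dx nz)+)
       (simp add: fun_eq_iff x block_mat1 map_matrix_cnj_simps matrix_inv_mat1 sp_simps
         scalar_product_vec1_vec2[of z] vec12_conj_vec algebra_simps)
qed

section \<open>The infinitesimal equations of the group and the kernel of the differential\<close>

lemma su_pq_trace:
  fixes X :: "complex^('p::finite + 'q::finite)^('p + 'q)"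
  assumes "X \<in> su_pq"
  shows "trace (map_matrix cnj (block_D X)) = trace (block_A X)"
proof -
  define E where "E t = matrix_exp (t *\<^sub>R X)" for t
  have E: "det (E t) = 1" "E t ** J0 ** conj_transpose (E t) = J0" for t
    using assms by (auto simp: su_pq_def lie_algebra_def SU_pq_def E_def)
  have E0: "E 0 = mat 1" by (simp add: E_def matrix_exp_0)
  have dE: "(E has_derivative (\<lambda>h. h *\<^sub>R X)) (at 0)"
    unfolding E_def by (rule has_derivative_matrix_exp)
  have "((\<lambda>t. det (E t)) has_derivative (\<lambda>h. trace (h *\<^sub>R X))) (at 0)"
    by (rule has_derivative_det_mat1[OF dE E0])
  \<comment> \<open>The determinant is constantly 1 along the one-parameter group, so by uniqueness
    its derivative is 0.\<close>
  then have "(\<lambda>h::real. trace (h *\<^sub>R X)) = (\<lambda>h. 0)"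
    unfolding E by (rule has_derivative_unique[OF _ has_derivative_const])
  from fun_cong[OF this, of 1] have tr: "trace (block_A X) + trace (block_D X) = 0"
    by (simp add: trace_block)
  note mm = bounded_bilinear.FDERIV[OF bounded_bilinear_matrix_matrix_mult]
  have "((\<lambda>t. E t ** J0 ** conj_transpose (E t)) has_derivative
      (\<lambda>h. (E 0 ** J0) ** conj_transpose (h *\<^sub>R X) + (E 0 ** 0 + (h *\<^sub>R X) ** J0) ** conj_transpose (E 0))) (at 0)"
    by (intro mm dE has_derivative_const bounded_linear.has_derivative[OF bounded_linear_conj(3) dE])
  then have "(\<lambda>h::real. (E 0 ** J0) ** conj_transpose (h *\<^sub>R X) + (E 0 ** 0 + (h *\<^sub>R X) ** J0) ** conj_transpose (E 0)) = (\<lambda>h. 0)"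
    unfolding E by (rule has_derivative_unique[OF _ has_derivative_const])
  from fun_cong[OF this, of 1]
  have "J0 ** conj_transpose X + X ** J0 = 0"
    by (simp add: E0 conj_transpose_def map_matrix_cnj_simps bounded_bilinear.zero_right[OF bounded_bilinear_matrix_matrix_mult])
  \<comment> \<open>Only the diagonal of the lower block matters for the trace. \<open>J0\<close>
    has entry -1 there, so up to sign the equation says that this entry of \<open>X\<close> is
    purely imaginary.\<close>
  then have "(J0 ** conj_transpose X + X ** J0) $ Inr b $ Inr b = 0" for b :: 'q
    by simp
  then have "cnj (X $ Inr b $ Inr b) + X $ Inr b $ Inr b = 0" for b :: 'q
    by (simp add: matrix_matrix_mult_def J0_def block_matrix_def sum_UNIV_Plus conj_transpose_def transpose_def map_matrix_def mat_def if_distrib if_distribR cong: if_cong) (metis add.right_inverse)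
  then have "trace (map_matrix cnj (block_D X)) + trace (block_D X) = 0"
    by (simp add: trace_def map_matrix_def block_D_def sum.distrib[symmetric])
  with tr show ?thesis by (simp add: add_eq_0_iff)
qed

lemma op_kernel_rep_differential:
  fixes \<sigma> :: "complex^('p::finite + 'q::finite)^('p + 'q) \<Rightarrow> ('p + 'q) operator"
  assumes \<sigma>: "is_harmonic_rep lam \<sigma>" and X: "X \<in> su_pq"
  shows "op_kernel lam (rep_differential \<sigma> X) z w =
    exp (of_real (lam / 2) * scalar_product z (conj_vec w)) *
      (of_real (lam / 2) *
        (- scalar_product (map_matrix cnj (block_C X) *v vec1 (conj_vec w)) (vec2 (conj_vec w))
         - scalar_product (map_matrix cnj (block_D X) *v vec2 z) (vec2 (conj_vec w))
         - scalar_product (block_A X *v vec1 z) (vec1 (conj_vec w))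
         + scalar_product (vec1 z) (map_matrix cnj (block_B X) *v vec2 z))
       - trace (block_A X))" (is "_ = ?k")
proof -
  have "matrix_exp (t *\<^sub>R X) \<in> SU_pq" for t
    using X by (simp add: su_pq_def lie_algebra_def)
  then have "\<sigma> (matrix_exp (t *\<^sub>R X)) (coherent lam w) z = harmonic_kernel lam (matrix_exp (t *\<^sub>R X)) z w" for t
    using \<sigma> by (simp add: is_harmonic_rep_def op_kernel_def)
  then have eq: "op_kernel lam (rep_differential \<sigma> X) z w = vector_derivative (\<lambda>t. harmonic_kernel lam (matrix_exp (t *\<^sub>R X)) z w) (at 0)"
    by (simp add: op_kernel_def rep_differential_def)
  have D: "((\<lambda>t. harmonic_kernel lam (matrix_exp (t *\<^sub>R X)) z w) has_derivative
    (\<lambda>h. exp (of_real (lam / 2) * scalar_product z (conj_vec w)) *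
      (of_real (lam / 2) *
        (- scalar_product (map_matrix cnj (block_C (h *\<^sub>R X)) *v vec1 (conj_vec w)) (vec2 (conj_vec w))
         - scalar_product (map_matrix cnj (block_D (h *\<^sub>R X)) *v vec2 z) (vec2 (conj_vec w))
         - scalar_product (block_A (h *\<^sub>R X) *v vec1 z) (vec1 (conj_vec w))
         + scalar_product (vec1 z) (map_matrix cnj (block_B (h *\<^sub>R X)) *v vec2 z))
       - trace (block_A (h *\<^sub>R X))))) (at 0)" (is "(_ has_derivative ?D) _")
    by (rule has_derivative_harmonic_kernel_mat1[OF has_derivative_matrix_exp]) (simp add: matrix_exp_0)
  have "((\<lambda>t. harmonic_kernel lam (matrix_exp (t *\<^sub>R X)) z w) has_vector_derivative ?k) (at 0)"
    unfolding has_vector_derivative_def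
  proof (rule has_derivative_eq_rhs[OF D], rule ext)
    fix h :: real
    show "?D h = h *\<^sub>R ?k"
      \<comment> \<open>\<open>D\<close> is expressed through the blocks of
        \<open>h *\<^sub>R X\<close>; linearity of a derivative in \<open>h\<close> pulls the scalar
        out and leaves the value at \<open>h = 1\<close>.\<close>
      using linear_scale[OF bounded_linear.linear[OF has_derivative_bounded_linear[OF D]], of h 1]
      by simp
  qed
  then show ?thesis
    unfolding eq by (rule vector_derivative_at)
qed

section \<open>Evaluation of the Weyl integral\<close>

lemma axis_Plus:
  "vec1 (axis (Inl a) u :: complex^('p::finite + 'q::finite)) = axis a u"
  "vec2 (axis (Inl a) u :: complex^('p::finite + 'q::finite)) = 0"
  "vec1 (axis (Inr b) u :: complex^('p::finite + 'q::finite)) = 0"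
  "vec2 (axis (Inr b) u :: complex^('p::finite + 'q::finite)) = axis b u"
  by (simp_all add: vec_eq_iff vec1_def vec2_def axis_def)

lemma conj_vec_axis: "conj_vec (axis i u) = axis i (cnj u)"
  by (simp add: vec_eq_iff conj_vec_def axis_def)

lemma scalar_product_matrix_axis:
  "scalar_product (N *v axis i u) (axis i v) = N $ i $ i * u * (v :: complex)"
  by (simp add: scalar_product_def matrix_vector_mult_def axis_def if_distrib[of "\<lambda>x. _ * x"] cong: if_cong)

lemma scalar_product_conj_vec: "scalar_product w (conj_vec w) = complex_of_real ((norm w)\<^sup>2)"
proof -
  have "(norm w)\<^sup>2 = (\<Sum>i\<in>UNIV. (norm (w $ i))\<^sup>2)"
    by (simp add: norm_vec_def L2_set_def sum_nonneg)
  then show ?thesis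
    by (simp only: scalar_product_def conj_vec_def vec_lambda_beta complex_norm_square of_real_sum)
qed

lemma scalar_product_commute: "scalar_product u v = scalar_product v (u :: complex^'n)"
  by (simp add: scalar_product_def mult.commute)

text \<open>The first pairing expands to the squared norm of \<open>z\<close> minus that of
  \<open>w\<close> plus two mixed terms. The remaining summands cancel the mixed terms and the norm
  of \<open>z\<close>, and they double the norm of \<open>w\<close>.\<close>

lemma weyl_exponent:
  fixes z w :: "complex^'n"
  shows "scalar_product (z + w) (conj_vec (z - w))
    + (- scalar_product z (conj_vec z) - scalar_product w (conj_vec w)
       + scalar_product z (conj_vec w) - scalar_product (conj_vec z) w)
   = - 2 * complex_of_real ((norm w)\<^sup>2)"
proof -
  interpret sp: bounded_bilinear "scalar_product :: complex^'n \<Rightarrow> complex^'n \<Rightarrow> complex"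
    by (rule bounded_bilinear_scalar_product)
  interpret cv: bounded_linear "conj_vec :: complex^'n \<Rightarrow> complex^'n"
    by (rule bounded_linear_conj)
  show ?thesis
    unfolding scalar_product_conj_vec[symmetric] scalar_product_commute[of "conj_vec z" w]
    by (simp add: sp.add_left sp.add_right sp.diff_left sp.diff_right cv.diff)
qed

text \<open>The real dimension is \<open>2 * CARD('n)\<close>, so the Gaussian mass is
  \<open>(pi / lam) ^ CARD('n)\<close>. With the density of \<open>dm_lambda\<close> this leaves
  \<open>1 / 2 ^ CARD('n)\<close>, the inverse of the prefactor of the Weyl symbol.\<close>

lemma has_bochner_integral_gaussian_dm_lambda:
  fixes L :: "complex^'n \<Rightarrow> complex" and Q :: "complex^'n \<Rightarrow> complex^'n \<Rightarrow> complex"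
  assumes lam: "lam > 0" and L: "bounded_linear L" and Q: "bounded_bilinear Q"
  shows "has_bochner_integral (dm_lambda lam) (\<lambda>x. exp (- lam * (norm x)\<^sup>2) *\<^sub>R (q + L x + Q x x))
    ((1 / 2 ^ CARD('n)) *\<^sub>R (q + (1 / (2 * lam)) *\<^sub>R (\<Sum>b\<in>Basis. Q b b)))"
proof -
  note int = has_bochner_integral_gaussian_quadratic[OF lam L Q, of q]
  have "sqrt (pi / lam) ^ DIM(complex^'n) = sqrt (pi / lam) ^ (2 * CARD('n))"
    by (simp add: mult.commute)
  also have "\<dots> = (pi / lam) ^ CARD('n)"
    unfolding power_mult using lam by simp
  finally have Z: "(lam / (2 * pi)) ^ CARD('n) * sqrt (pi / lam) ^ DIM(complex^'n) = 1 / 2 ^ CARD('n)"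
    using lam by (simp add: power_mult_distrib[symmetric] power_one_over[symmetric])
  show ?thesis
    unfolding dm_lambda_def
  proof (rule has_bochner_integral_density)
    show "has_bochner_integral lborel
      (\<lambda>x. (lam / (2 * pi)) ^ CARD('n) *\<^sub>R exp (- lam * (norm x)\<^sup>2) *\<^sub>R (q + L x + Q x x))
      ((1 / 2 ^ CARD('n)) *\<^sub>R (q + (1 / (2 * lam)) *\<^sub>R (\<Sum>b\<in>Basis. Q b b)))"
      using has_bochner_integral_scaleR_right[OF int, of "(lam / (2 * pi)) ^ CARD('n)"]
      by (simp only: scaleR_scaleR Z)
  qed (use lam borel_measurable_has_bochner_integral[OF int] in auto)
qed

theorem proposition4p6:
  fixes lam :: real
    and \<sigma> :: "complex^('p::finite + 'q::finite)^('p + 'q) \<Rightarrow> ('p + 'q) operator"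
    and X :: "complex^('p + 'q)^('p + 'q)"
    and A :: "complex^'p^'p" and B :: "complex^'q^'p"
    and C :: "complex^'p^'q" and D :: "complex^'q^'q"
    and z1 :: "complex^'p" and z2 :: "complex^'q"
  assumes "lam > 0"
    and "is_harmonic_rep lam \<sigma>"
    and "X \<in> su_pq"
    and "X = block_matrix A B C D"
  shows "weyl_symbol lam (rep_differential \<sigma> X) (join_vec z1 z2) =
    - of_real (lam / 2) *
      (scalar_product (map_matrix cnj C *v conj_vec z1) (conj_vec z2)
       + scalar_product (map_matrix cnj D *v z2) (conj_vec z2)
       + scalar_product (A *v z1) (conj_vec z1)
       - scalar_product z1 (map_matrix cnj B *v z2))"
proof -
  define z where "z = join_vec z1 z2"
  have z: "vec1 z = z1" "vec2 z = z2" by (simp_all add: z_def)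
  have blocks: "block_A X = A" "block_B X = B" "block_C X = C" "block_D X = D"
    using assms(4) by simp_all
  have tr: "trace (map_matrix cnj D) = trace A"
    using su_pq_trace[OF assms(3)] by (simp add: blocks)
  \<comment> \<open>The polynomial factor of the kernel at \<open>z\<close>, \<open>w\<close> is
    built from \<open>- P w w - R z w + S z z\<close>, the three forms being grouped by which kernel
    arguments they take. All are real bilinear in spite of the conjugations.\<close>
  define P where "P x y = scalar_product (map_matrix cnj C *v conj_vec (vec1 x)) (conj_vec (vec2 y))" for x y :: "complex^('p + 'q)"
  define R where "R x y = scalar_product (map_matrix cnj D *v vec2 x) (conj_vec (vec2 y))
    + scalar_product (A *v vec1 x) (conj_vec (vec1 y))" for x y :: "complex^('p + 'q)"
  define S where "S x y = scalar_product (vec1 x) (map_matrix cnj B *v vec2 y)" for x y :: "complex^('p + 'q)"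
  note mv = bounded_linear_compose[OF bounded_bilinear.bounded_linear_right[OF bounded_bilinear_matrix_vector_mult_complex]]
  note cv = bounded_linear_compose[OF bounded_linear_conj(1)]
  note sp = bounded_bilinear.comp[OF bounded_bilinear_scalar_product]
  interpret P: bounded_bilinear P
    unfolding P_def by (intro sp mv cv bounded_linear_blocks)
  interpret S: bounded_bilinear S
    unfolding S_def by (intro sp mv cv bounded_linear_blocks)
  interpret R1: bounded_bilinear "\<lambda>x y :: complex^('p + 'q). scalar_product (map_matrix cnj D *v vec2 x) (conj_vec (vec2 y))"
    by (intro sp mv cv bounded_linear_blocks)
  interpret R2: bounded_bilinear "\<lambda>x y :: complex^('p + 'q). scalar_product (A *v vec1 x) (conj_vec (vec1 y))"
    by (intro sp mv cv bounded_linear_blocks)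
  interpret R: bounded_bilinear R
    unfolding bilinear_conv_bounded_bilinear[symmetric] bilinear_def R_def
    by (intro conjI allI linear_compose_add bounded_linear.linear R1.bounded_linear_left
        R1.bounded_linear_right R2.bounded_linear_left R2.bounded_linear_right)
  define l where "l = complex_of_real (lam / 2)"
  \<comment> \<open>\<open>q\<close>, \<open>L\<close> and \<open>Q\<close> are the parts of degree
    0, 1 and 2 in \<open>w\<close> after inserting \<open>z + w\<close> and \<open>z - w\<close>.
    The opposite signs of \<open>w\<close> turn \<open>- R\<close> into \<open>+ R\<close> in
    \<open>Q\<close>, which gives its trace the sign needed to cancel
    \<open>- trace A\<close>.\<close>
  define q where "q = l * (- P z z - R z z + S z z) - trace A"
  define L where "L w = l * (P z w + P w z + R z w - R w z + S z w + S w z)" for w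
  define Q where "Q x y = l * (- P x y + R x y + S x y)" for x y
  have L: "bounded_linear L"
    unfolding L_def
    by (intro bounded_linear_const_mult bounded_linear_add bounded_linear_sub P.bounded_linear_left
        P.bounded_linear_right R.bounded_linear_left R.bounded_linear_right S.bounded_linear_left S.bounded_linear_right)
  have Q: "bounded_bilinear Q"
    unfolding bilinear_conv_bounded_bilinear[symmetric] bilinear_def Q_def linear_conv_bounded_linear
    by (intro conjI allI bounded_linear_const_mult bounded_linear_add bounded_linear_minus P.bounded_linear_left
        P.bounded_linear_right R.bounded_linear_left R.bounded_linear_right S.bounded_linear_left S.bounded_linear_right)
  have integrand: "op_kernel lam (rep_differential \<sigma> X) (z + w) (z - w) *
      exp (of_real (lam / 2) *
        (- scalar_product z (conj_vec z) - scalar_product w (conj_vec w)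
         + scalar_product z (conj_vec w) - scalar_product (conj_vec z) w))
    = exp (- lam * (norm w)\<^sup>2) *\<^sub>R (q + L w + Q w w)" for w
  proof -
    have "op_kernel lam (rep_differential \<sigma> X) (z + w) (z - w) =
        exp (l * scalar_product (z + w) (conj_vec (z - w))) *
        (l * (- P (z - w) (z - w) - R (z + w) (z - w) + S (z + w) (z + w)) - trace A)"
      by (simp add: op_kernel_rep_differential[OF assms(2,3)] blocks P_def R_def S_def l_def vec12_conj_vec)
    also have "l * (- P (z - w) (z - w) - R (z + w) (z - w) + S (z + w) (z + w)) - trace A = q + L w + Q w w"
      by (simp add: q_def L_def Q_def P.diff_left P.diff_right R.add_left R.diff_right
          S.add_left S.add_right algebra_simps)
    finally have kernel: "op_kernel lam (rep_differential \<sigma> X) (z + w) (z - w) =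
        exp (l * scalar_product (z + w) (conj_vec (z - w))) * (q + L w + Q w w)" .
    have gauss: "exp (l * scalar_product (z + w) (conj_vec (z - w))) *
        exp (l * (- scalar_product z (conj_vec z) - scalar_product w (conj_vec w)
          + scalar_product z (conj_vec w) - scalar_product (conj_vec z) w))
      = of_real (exp (- lam * (norm w)\<^sup>2))"
      unfolding exp_add[symmetric] distrib_left[symmetric] weyl_exponent
      by (simp add: l_def exp_of_real[symmetric])
    show ?thesis
      unfolding kernel l_def[symmetric] scaleR_conv_of_real gauss[symmetric] by (simp only: mult_ac)
  qed
  note zeros = bounded_bilinear.zero_left[OF bounded_bilinear_scalar_product]
    bounded_bilinear.zero_right[OF bounded_bilinear_scalar_product]
    linear_0[OF bounded_linear.linear[OF bounded_linear_conj(1)]]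
  \<comment> \<open>For both basis values 1 and \<i> of \<open>u\<close> the factor
    \<open>u * cnj u\<close> is 1, so every diagonal entry is counted twice in the real trace of
    \<open>Q\<close>.\<close>
  have Q_axis: "Q (axis (Inl a) u) (axis (Inl a) u) = l * (A $ a $ a * (u * cnj u))"
    "Q (axis (Inr b) u) (axis (Inr b) u) = l * (map_matrix cnj D $ b $ b * (u * cnj u))" for a b u
    by (simp_all add: Q_def P_def R_def S_def axis_Plus conj_vec_axis scalar_product_matrix_axis zeros)
  \<comment> \<open>The forms \<open>P\<close> and \<open>S\<close> couple the two blocks, so they vanish on the diagonal.\<close>
  have "(\<Sum>b\<in>Basis. Q b b) = l * (2 * (trace A + trace (map_matrix cnj D)))"
    by (simp add: sum_Basis_vec Basis_complex_def sum_UNIV_Plus Q_axis trace_def sum_distrib_left[symmetric]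
        sum.distrib distrib_left)
  \<comment> \<open>Since the two traces agree, the sum is \<open>l * 4 * trace A\<close> with
    \<open>l = lam / 2\<close>, that is \<open>2 * lam * trace A\<close>.\<close>
  then have trace_cancel: "(1 / (2 * lam)) *\<^sub>R (\<Sum>b\<in>Basis. Q b b) = trace A"
    using assms(1) by (simp add: tr l_def scaleR_conv_of_real)
  have "weyl_symbol lam (rep_differential \<sigma> X) z = 2 ^ CARD('p + 'q) *
      (LINT w|dm_lambda lam. exp (- lam * (norm w)\<^sup>2) *\<^sub>R (q + L w + Q w w))"
    unfolding weyl_symbol_def integrand ..
  also have "\<dots> = q + trace A"
    unfolding has_bochner_integral_integral_eq[OF has_bochner_integral_gaussian_dm_lambda[OF assms(1) L Q]] trace_cancel
    by (simp add: scaleR_conv_of_real)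
  also have "\<dots> = l * (- P z z - R z z + S z z)"
    by (simp add: q_def)
  finally show ?thesis
    by (simp add: z_def[symmetric] P_def R_def S_def z l_def algebra_simps)
qed

end
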